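(* Let $a,b\in\mathbb R$ with $d(a-jh,b-ih)\neq0$ for $0\le i\le j\le n-1$. The $h$--$\gamma$ Bernstein basis functions $B_k^n(x,[a,b];\gamma,h)$ satisfy $B_0^0(x,[a,b];\gamma,h)=1$ and the recurrence $$B_k^n(x,[a,b];\gamma,h)=\frac{d(a-(k-1)h,x)}{d(a-(k-1)h,b-(k-1)h)}\,B_{k-1}^{n-1}(x-h,[a-h,b];\gamma,h)+\frac{d(x,b-kh)}{d(a-kh,b-kh)}\,B_k^{n-1}(x-h,[a-h,b];\gamma,h),$$ for $k=0,\ldots,n$ and all $x\in\mathbb R$, where $B_{-1}^{n-1}(x,[a,b];\gamma,h)=0$ and $B_n^{n-1}(x,[a,b];\gamma,h)=0$ (so that the corresponding term is $0$).
   Context: Let $n\ge 1$ be an integer and $h\in\mathbb R$ fixed. Let $\gamma_1,\gamma_2:\mathbb R\to\mathbb R$ be continuous, linearly independent functions. They are assumed translation invariant: for every $s\in\mathbb R$ there is an invertible $2\times2$ matrix $C(s)$ with $\begin{pmatrix}\gamma_1(x-s)\\ \gamma_2(x-s)\end{pmatrix}=C(s)\begin{pmatrix}\gamma_1(x)\\ \gamma_2(x)\end{pmatrix}$ for all $x$. Put $d(u,v)=\gamma_1(u)\gamma_2(v)-\gamma_2(u)\gamma_1(v)$. For $0\le k\le n$ put $G_{n,k}(t;h)=\sum_{I\subseteq\{1,\ldots,n\},\,|I|=k}\ \prod_{i\in I}\gamma_1(t-(i-1)h)\prod_{i\in\{1,\ldots,n\}\setminus I}\gamma_2(t-(i-1)h)$.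 Standing assumption: $h$ is such that the functions $t\mapsto G_{n,k}(t;h)$, $k=0,\ldots,n$, are linearly independent. $h$--$\gamma$ Bernstein basis functions: for an integer $m\ge0$ and $\alpha,\beta\in\mathbb R$ (the interval $[\alpha,\beta]$ is the one determined by these endpoints, in either order) with $d(\alpha-jh,\beta-ih)\ne0$ for $0\le i\le j\le m-1$, take arbitrary initial values $P_0^0,\ldots,P_m^0$ and define $$P_i^{k+1}(x)=\frac{d(x-kh,\beta-ih)}{d(\alpha-(i+k)h,\beta-ih)}P_i^k(x)+\frac{d(\alpha-(i+k)h,x-kh)}{d(\alpha-(i+k)h,\beta-ih)}P_{i+1}^k(x),\quad 0\le i\le m-k-1,\ 0\le k\le m-1.$$ Then $P_0^m(x)$ is a linear combination of the $P_k^0$, and $B_k^m(x,[\alpha,\beta];\gamma,h)$ is by definition the coefficient of $P_k^0$: $P_0^m(x)=\sum_{k=0}^mP_k^0\,B_k^m(x,[\alpha,\beta];\gamma,h)$. *)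

theory Defs
  imports "HOL-Analysis.Analysis"
begin

text \<open>The pair of functions is a family \<open>\<gamma> :: 2 \<Rightarrow> real \<Rightarrow> real\<close>, with members \<open>\<gamma> 1\<close> and \<open>\<gamma> 2\<close>
  (in the two-element index type, \<open>2 = 0 \<noteq> 1\<close>).\<close>

definition lin_indep_family :: "('i \<Rightarrow> real \<Rightarrow> real) \<Rightarrow> 'i set \<Rightarrow> bool" where
  "lin_indep_family f I \<longleftrightarrow>
     (\<forall>c. (\<forall>t. (\<Sum>i\<in>I. c i * f i t) = 0) \<longrightarrow> (\<forall>i\<in>I. c i = 0))"

definition translation_invariant :: "(2 \<Rightarrow> real \<Rightarrow> real) \<Rightarrow> bool" where
  "translation_invariant \<gamma> \<longleftrightarrow>
     (\<forall>s. \<exists>C :: real^2^2. invertible C \<and>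
        (\<forall>x. (\<chi> i. \<gamma> i (x - s)) = C *v (\<chi> i. \<gamma> i x)))"

definition det_\<gamma> :: "(2 \<Rightarrow> real \<Rightarrow> real) \<Rightarrow> real \<Rightarrow> real \<Rightarrow> real" where
  "det_\<gamma> \<gamma> u v = \<gamma> 1 u * \<gamma> 2 v - \<gamma> 2 u * \<gamma> 1 v"

definition G_fun :: "(2 \<Rightarrow> real \<Rightarrow> real) \<Rightarrow> real \<Rightarrow> nat \<Rightarrow> nat \<Rightarrow> real \<Rightarrow> real" where
  "G_fun \<gamma> h n k t =
     (\<Sum>I | I \<subseteq> {1..n} \<and> card I = k.
        (\<Prod>i\<in>I. \<gamma> 1 (t - (real i - 1) * h)) *
        (\<Prod>i\<in>{1..n} - I. \<gamma> 2 (t - (real i - 1) * h)))"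

text \<open>\<open>eval_alg \<gamma> h \<alpha> \<beta> x P k i\<close> is the value \<open>P_i^k(x)\<close> of the evaluation algorithm on
  \<open>[\<alpha>, \<beta>]\<close> started from \<open>P_i^0 = P i\<close>. It does not depend on the degree \<open>m\<close>: the algorithm of
  degree \<open>m\<close> is the triangle \<open>i + k \<le> m\<close>, whose entries only use \<open>P 0, \<dots>, P m\<close>.\<close>

primrec eval_alg ::
  "(2 \<Rightarrow> real \<Rightarrow> real) \<Rightarrow> real \<Rightarrow> real \<Rightarrow> real \<Rightarrow> real \<Rightarrow> (nat \<Rightarrow> real) \<Rightarrow> nat \<Rightarrow> nat \<Rightarrow> real" where
  "eval_alg \<gamma> h \<alpha> \<beta> x P 0 = P"
| "eval_alg \<gamma> h \<alpha> \<beta> x P (Suc k) = (\<lambda>i.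
     det_\<gamma> \<gamma> (x - real k * h) (\<beta> - real i * h)
       / det_\<gamma> \<gamma> (\<alpha> - real (i + k) * h) (\<beta> - real i * h) * eval_alg \<gamma> h \<alpha> \<beta> x P k i
     + det_\<gamma> \<gamma> (\<alpha> - real (i + k) * h) (x - real k * h)
       / det_\<gamma> \<gamma> (\<alpha> - real (i + k) * h) (\<beta> - real i * h) * eval_alg \<gamma> h \<alpha> \<beta> x P k (i + 1))"

text \<open>\<open>bernstein_h\<gamma> \<gamma> h m k \<alpha> \<beta> x\<close> is \<open>B_k^m(x, [\<alpha>, \<beta>]; \<gamma>, h)\<close>, the coefficient of \<open>P k\<close> in the
  final value \<open>P_0^m(x)\<close>. The index \<open>k\<close> is an integer, and the value is \<open>0\<close> for \<open>k\<close> outside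
  \<open>{0..m}\<close>, in accordance with the convention \<open>B_{-1}^m = B_{m+1}^m = 0\<close>. The description is
  proper, see \<open>ex1_eval_alg_coeffs\<close> below.\<close>

definition bernstein_h\<gamma> ::
  "(2 \<Rightarrow> real \<Rightarrow> real) \<Rightarrow> real \<Rightarrow> nat \<Rightarrow> int \<Rightarrow> real \<Rightarrow> real \<Rightarrow> real \<Rightarrow> real" where
  "bernstein_h\<gamma> \<gamma> h m k \<alpha> \<beta> x =
     (THE c :: int \<Rightarrow> real.
        (\<forall>j. j \<notin> {0..int m} \<longrightarrow> c j = 0) \<and>
        (\<forall>P. eval_alg \<gamma> h \<alpha> \<beta> x P m 0 = (\<Sum>j=0..m. P j * c (int j)))) k"

lemma eval_alg_expand:
  assumes "i + k \<le> m"
  shows "eval_alg \<gamma> h \<alpha> \<beta> x P k i =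
    (\<Sum>j=0..m. P j * eval_alg \<gamma> h \<alpha> \<beta> x (\<lambda>l. if l = j then 1 else 0) k i)"
  using assms
proof (induction k arbitrary: i)
  case 0
  have "(\<Sum>j=0..m. P j * (if i = j then 1 else 0)) = (\<Sum>j=0..m. if i = j then P j else 0)"
    by (intro sum.cong) auto
  also have "\<dots> = P i" using 0 by simp
  finally show ?case by simp
next
  case (Suc k)
  let ?e = "\<lambda>j. eval_alg \<gamma> h \<alpha> \<beta> x (\<lambda>l. if l = j then 1 else 0) k"
  have IH: "eval_alg \<gamma> h \<alpha> \<beta> x P k i = (\<Sum>j=0..m. P j * ?e j i)"
    "eval_alg \<gamma> h \<alpha> \<beta> x P k (i + 1) = (\<Sum>j=0..m. P j * ?e j (i + 1))"
    by (rule Suc.IH, use Suc.prems in simp)+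
  have linear: "u * (\<Sum>j=0..m. P j * ?e j i) + v * (\<Sum>j=0..m. P j * ?e j (i + 1)) =
      (\<Sum>j=0..m. P j * (u * ?e j i + v * ?e j (i + 1)))" for u v
    by (simp add: sum_distrib_left sum.distrib algebra_simps)
  show ?case
    unfolding eval_alg.simps(2) IH linear ..
qed

lemma ex1_eval_alg_coeffs:
  "\<exists>!c :: int \<Rightarrow> real.
     (\<forall>j. j \<notin> {0..int m} \<longrightarrow> c j = 0) \<and>
     (\<forall>P. eval_alg \<gamma> h \<alpha> \<beta> x P m 0 = (\<Sum>j=0..m. P j * c (int j)))"
proof (rule ex_ex1I)
  let ?c = "\<lambda>j. if j \<in> {0..int m}
    then eval_alg \<gamma> h \<alpha> \<beta> x (\<lambda>l. if l = nat j then 1 else 0) m 0 else 0"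
  have "eval_alg \<gamma> h \<alpha> \<beta> x P m 0 = (\<Sum>j=0..m. P j * ?c (int j))" for P
    using eval_alg_expand[of 0 m m \<gamma> h \<alpha> \<beta> x P] by simp
  then show "\<exists>c :: int \<Rightarrow> real. (\<forall>j. j \<notin> {0..int m} \<longrightarrow> c j = 0) \<and>
      (\<forall>P. eval_alg \<gamma> h \<alpha> \<beta> x P m 0 = (\<Sum>j=0..m. P j * c (int j)))"
    by (intro exI[of _ ?c] conjI allI impI) (rule if_not_P)
next
  fix c c' :: "int \<Rightarrow> real"
  assume c: "(\<forall>j. j \<notin> {0..int m} \<longrightarrow> c j = 0) \<and>
      (\<forall>P. eval_alg \<gamma> h \<alpha> \<beta> x P m 0 = (\<Sum>j=0..m. P j * c (int j)))"
    and c': "(\<forall>j. j \<notin> {0..int m} \<longrightarrow> c' j = 0) \<and>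
      (\<forall>P. eval_alg \<gamma> h \<alpha> \<beta> x P m 0 = (\<Sum>j=0..m. P j * c' (int j)))"
  have delta: "(\<Sum>j=0..m. (if j = i then 1 else 0) * e (int j)) = e (int i)"
    if "i \<le> m" for i and e :: "int \<Rightarrow> real"
  proof -
    have "(\<Sum>j=0..m. (if j = i then 1 else 0) * e (int j)) = (\<Sum>j=0..m. if j = i then e (int j) else 0)"
      by (intro sum.cong) auto
    then show ?thesis using that by simp
  qed
  show "c = c'"
  proof
    fix j
    show "c j = c' j"
    proof (cases "j \<in> {0..int m}")
      case True
      then obtain i where i: "j = int i" "i \<le> m"
        by (metis atLeastAtMost_iff nonneg_int_cases of_nat_le_iff)
      have "(\<Sum>j=0..m. (if j = i then 1 else 0) * c (int j)) =
          (\<Sum>j=0..m. (if j = i then 1 else 0) * c' (int j))"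
        using c[THEN conjunct2, THEN spec, of "\<lambda>j. if j = i then 1 else 0"]
          c'[THEN conjunct2, THEN spec, of "\<lambda>j. if j = i then 1 else 0"]
        by (rule trans[OF sym])
      then show ?thesis using i by (simp only: delta)
    next
      case False
      then show ?thesis
        using c[THEN conjunct1, THEN spec, of j] c'[THEN conjunct1, THEN spec, of j] by simp
    qed
  qed
qed

lemma bernstein_h\<gamma>_outside: "k \<notin> {0..int m} \<Longrightarrow> bernstein_h\<gamma> \<gamma> h m k \<alpha> \<beta> x = 0"
  unfolding bernstein_h\<gamma>_def
  using theI'[OF ex1_eval_alg_coeffs[of m \<gamma> h \<alpha> \<beta> x]] by blast

lemma eval_alg_eq_sum_bernstein_h\<gamma>:
  "eval_alg \<gamma> h \<alpha> \<beta> x P m 0 = (\<Sum>k=0..m. P k * bernstein_h\<gamma> \<gamma> h m (int k) \<alpha> \<beta> x)"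
  unfolding bernstein_h\<gamma>_def
  using theI'[OF ex1_eval_alg_coeffs[of m \<gamma> h \<alpha> \<beta> x]] by blast

end

theory Submission
  imports Defs
begin

text \<open>Shifting the left endpoint and the argument by \<open>h\<close> turns the weights of step \<open>k\<close> of the
  evaluation algorithm into those of step \<open>k + 1\<close>. Hence the algorithm of degree \<open>n\<close> on \<open>[a, b]\<close> at
  \<open>x\<close> is one step followed by the algorithm of degree \<open>n - 1\<close> on \<open>[a - h, b]\<close> at \<open>x - h\<close>. The
  recurrence compares the coefficients of the initial value with index \<open>k\<close>, which enters the first
  step only in the entries \<open>k - 1\<close> and \<open>k\<close>.\<close>

lemma eval_alg_Suc_shift:
  "eval_alg \<gamma> h \<alpha> \<beta> x P (Suc k) =
    eval_alg \<gamma> h (\<alpha> - h) \<beta> (x - h) (eval_alg \<gamma> h \<alpha> \<beta> x P 1) k"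
proof (induction k)
  case 0
  show ?case by simp
next
  case (Suc k)
  \<comment> \<open>The right endpoint stays put: \<open>\<beta>\<close> enters the weights only
    through \<open>\<beta> - real i * h\<close>, which does not depend on the step.\<close>
  have x: "x - real (Suc k) * h = x - h - real k * h"
    and \<alpha>: "\<alpha> - real (i + Suc k) * h = \<alpha> - h - real (i + k) * h" for i
    by (simp_all add: algebra_simps)
  show ?case
    unfolding eval_alg.simps(2)[of _ _ _ _ _ _ "Suc k"] Suc.IH x \<alpha>
    unfolding eval_alg.simps(2) ..
qed

text \<open>Starting from a Kronecker delta leaves a single term of the Bernstein expansion.\<close>

lemma bernstein_h\<gamma>_eq_eval_alg:
  assumes "k \<le> m"
  shows "bernstein_h\<gamma> \<gamma> h m (int k) \<alpha> \<beta> x = eval_alg \<gamma> h \<alpha> \<beta> x (\<lambda>l. of_bool (l = k)) m 0"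
  using assms by (simp add: eval_alg_eq_sum_bernstein_h\<gamma> of_bool_def if_distribR if_distrib[of \<open>(*)\<close>] cong: if_cong)

lemma bernstein_h\<gamma>_Suc:
  assumes "k \<in> {0..int (Suc m)}"
  shows "bernstein_h\<gamma> \<gamma> h (Suc m) k \<alpha> \<beta> x =
    det_\<gamma> \<gamma> (\<alpha> - (real_of_int k - 1) * h) x
      / det_\<gamma> \<gamma> (\<alpha> - (real_of_int k - 1) * h) (\<beta> - (real_of_int k - 1) * h)
      * bernstein_h\<gamma> \<gamma> h m (k - 1) (\<alpha> - h) \<beta> (x - h)
    + det_\<gamma> \<gamma> x (\<beta> - real_of_int k * h)
      / det_\<gamma> \<gamma> (\<alpha> - real_of_int k * h) (\<beta> - real_of_int k * h)
      * bernstein_h\<gamma> \<gamma> h m k (\<alpha> - h) \<beta> (x - h)"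
proof -
  \<comment> \<open>The argument is real because \<open>v\<close> is also taken at
    \<open>k - 1\<close>, which is -1 for \<open>k = 0\<close>.\<close>
  define v w where
    "v i = det_\<gamma> \<gamma> (\<alpha> - i * h) x / det_\<gamma> \<gamma> (\<alpha> - i * h) (\<beta> - i * h)" and
    "w i = det_\<gamma> \<gamma> x (\<beta> - i * h) / det_\<gamma> \<gamma> (\<alpha> - i * h) (\<beta> - i * h)" for i :: real
  let ?B = "\<lambda>i. bernstein_h\<gamma> \<gamma> h m i (\<alpha> - h) \<beta> (x - h)"
  obtain l where k: "k = int l" and l: "l \<le> Suc m"
    using assms by (metis atLeastAtMost_iff nonneg_int_cases of_nat_le_iff)
  \<comment> \<open>In step 0 both endpoints are shifted by the same multiple \<open>i * h\<close>,
    hence the diagonal denominators.\<close>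
  have first: "eval_alg \<gamma> h \<alpha> \<beta> x P 1 i = w (real i) * P i + v (real i) * P (Suc i)" for P i
    by (simp add: v_def w_def)
  \<comment> \<open>For \<open>l = 0\<close> no index matches, in accordance with the default value
    0 of \<open>?B (- 1)\<close>.\<close>
  have left: "(\<Sum>i=0..m. of_bool (Suc i = l) * (v (real i) * ?B (int i))) =
      v (real_of_int k - 1) * ?B (k - 1)"
  proof (cases l)
    case 0
    then show ?thesis by (simp add: k bernstein_h\<gamma>_outside)
  next
    case (Suc l')
    then show ?thesis using l by (simp add: k of_bool_def if_distribR if_distrib[of \<open>(*)\<close>] cong: if_cong)
  qed
  \<comment> \<open>The other boundary case is \<open>l = Suc m\<close>: the sum is empty of matches
    and \<open>?B (int (Suc m))\<close> is 0.\<close>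
  have right: "(\<Sum>i=0..m. of_bool (i = l) * (w (real i) * ?B (int i))) = w (real_of_int k) * ?B k"
    using l by (cases "l \<le> m")
      (simp_all add: k bernstein_h\<gamma>_outside of_bool_def if_distribR if_distrib[of \<open>(*)\<close>] cong: if_cong)
  \<comment> \<open>The first step turns the delta at \<open>l\<close> into new initial values,
    which the Bernstein functions of degree \<open>m\<close> on the shifted interval then
    weight.\<close>
  have "bernstein_h\<gamma> \<gamma> h (Suc m) k \<alpha> \<beta> x =
      (\<Sum>i=0..m. (w (real i) * of_bool (i = l) + v (real i) * of_bool (Suc i = l)) * ?B (int i))"
    unfolding k bernstein_h\<gamma>_eq_eval_alg[OF l] eval_alg_Suc_shift
      eval_alg_eq_sum_bernstein_h\<gamma>[of _ _ "\<alpha> - h"] first ..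
  also have "\<dots> = (\<Sum>i=0..m. of_bool (Suc i = l) * (v (real i) * ?B (int i))) +
      (\<Sum>i=0..m. of_bool (i = l) * (w (real i) * ?B (int i)))"
    unfolding sum.distrib[symmetric] by (intro sum.cong) (simp_all add: algebra_simps)
  finally show ?thesis
    unfolding left right unfolding v_def w_def .
qed

theorem theorem5p2:
  fixes \<gamma> :: "2 \<Rightarrow> real \<Rightarrow> real" and h a b :: real and n :: nat
  assumes "n \<ge> 1"
    and "\<And>i. continuous_on UNIV (\<gamma> i)"
    and "lin_indep_family \<gamma> UNIV"
    and "translation_invariant \<gamma>"
    and "lin_indep_family (G_fun \<gamma> h n) {0..n}"
    and "\<And>i j. i \<le> j \<Longrightarrow> j \<le> n - 1 \<Longrightarrow>
           det_\<gamma> \<gamma> (a - real j * h) (b - real i * h) \<noteq> 0"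
  shows "(\<forall>x. bernstein_h\<gamma> \<gamma> h 0 0 a b x = 1) \<and>
    (\<forall>k\<in>{0..int n}. \<forall>x.
       bernstein_h\<gamma> \<gamma> h n k a b x =
         det_\<gamma> \<gamma> (a - (real_of_int k - 1) * h) x
           / det_\<gamma> \<gamma> (a - (real_of_int k - 1) * h) (b - (real_of_int k - 1) * h)
           * bernstein_h\<gamma> \<gamma> h (n - 1) (k - 1) (a - h) b (x - h)
       + det_\<gamma> \<gamma> x (b - real_of_int k * h)
           / det_\<gamma> \<gamma> (a - real_of_int k * h) (b - real_of_int k * h)
           * bernstein_h\<gamma> \<gamma> h (n - 1) k (a - h) b (x - h))"
proof -
  have "bernstein_h\<gamma> \<gamma> h 0 0 a b x = 1" for x
    using bernstein_h\<gamma>_eq_eval_alg[of 0 0] by simp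
  moreover obtain m where "n = Suc m"
    using \<open>n \<ge> 1\<close> by (cases n) auto
  ultimately show ?thesis
    using bernstein_h\<gamma>_Suc[of _ m \<gamma> h a b] by simp
qed

end
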